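(* (Negative Boltzmann-Gibbs-Shannon entropy.) Let $n\in\mathbb N$, let $X:=\mathbb R^n$ with an arbitrary norm $\|\cdot\|$, let $U:=(0,\infty)^n$, and define $b:X\to(-\infty,\infty]$ by $b(x):=\sum_{k=1}^nx_k\log(x_k)$ for $x\in\overline U=[0,\infty)^n$ (with $0\log 0:=0$) and $b(x):=\infty$ otherwise. Let $c_2,c_\infty>0$ be constants with $c_2\|v\|\le\|v\|_2$ and $\|v\|_\infty\le c_\infty\|v\|$ for all $v\in X$. Then: (a) $b$ is strongly convex on every nonempty, bounded and convex subset of $\overline U$; moreover, if $S$ is a nonempty, bounded and convex subset of $U$ and $M_S>0$ satisfies $\|s\|\le M_S$ for all $s\in S$, then $\mu[S]:=c_2^2/(c_\infty M_S)$ is a strong convexity parameter of $b$ on $S$. (b) For each $x\in\overline U$, $b$ is uniformly convex relative to $(\{x\},U\cap\{w\in X:\|w\|>2\|x\|\})$ with $\psi(t):=\frac{c_2^2}{4c_\infty}t$, $t\in[0,\infty)$, as a relative gauge. (c) $b$ is not uniformly convex on $U$. (d) $b$ is a sequentially consistent Bregman function (with zone $U$) which has the limiting difference property, and for all $y\in U$ and $\gamma\in\mathbb R$ the second type level-set $\{x\in\mathrm{dom}(b):B(x,y)\le\gamma\}$ is bounded.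
   Context: $\|v\|_2$ and $\|v\|_\infty$ are the Euclidean and max norms; $\log$ is the natural logarithm. $\mathrm{dom}(b):=\{x\in X:b(x)<\infty\}$. For convex $b$ and nonempty $S_1,S_2\subseteq\mathrm{dom}(b)$, $b$ is uniformly convex relative to $(S_1,S_2)$ with relative gauge $\psi:[0,\infty)\to[0,\infty]$ (where $\psi(t)>0$ for $t>0$) if $b(\lambda x+(1-\lambda)y)+\lambda(1-\lambda)\psi(\|x-y\|)\le\lambda b(x)+(1-\lambda)b(y)$ for all $\lambda\in(0,1)$, $(x,y)\in S_1\times S_2$. If $S_1=S_2=S$, $b$ is uniformly convex on $S$; if also $\psi(t)=\frac12\mu t^2$ with $\mu>0$, $b$ is strongly convex on $S$ with strong convexity parameter $\mu$. Divergence: $B(x,y):=b(x)-b(y)-\langle b'(y),x-y\rangle$ for $(x,y)\in\mathrm{dom}(b)\times U$, and $B(x,y):=\infty$ otherwise, where $b'$ is the (Gâteaux) derivative. $b$ is a Bregman function with zone $U$ if: (i) $U=\mathrm{Int}(\mathrm{dom}(b))\ne\emptyset$ and $b$ is Gâteaux differentiable in $U$; (ii) $b$ is convex and lower semicontinuous on $X$ and strictly convex on $\mathrm{dom}(b)$; (iii) for each $\gamma\in\mathbb R$ and $x\in\mathrm{dom}(b)$ the set $\{y\in U:B(x,y)\le\gamma\}$ is bounded; (iv) if $x\in\mathrm{dom}(b)$ and $(y_i)$ in $U$ satisfy $\|x-y_i\|\to0$, then $B(x,y_i)\to0$; (v) if $(x_i)$ is a bounded sequence in $\mathrm{dom}(b)$,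 $(y_i)$ is a sequence in $U$, $B(x_i,y_i)\to0$ and $\|y_i-y\|\to0$ for some $y\in\mathrm{dom}(b)$, then $\|x_i-y\|\to0$. $b$ has the limiting difference property if for each $x\in\mathrm{dom}(b)$ and each sequence $(y_i)$ in $U$ converging (weakly) to some $y\in U$, $B(x,y)=\lim_{i\to\infty}(B(x,y_i)-B(y,y_i))$. $b$ is sequentially consistent if for all sequences $(x_i)$ in $\mathrm{dom}(b)$ and $(y_i)$ in $U$ with $(y_i)$ bounded and $B(x_i,y_i)\to0$ one has $\|x_i-y_i\|\to0$. *)

theory Defs
  imports "HOL-Analysis.Analysis"
begin

text \<open>
  The space \<open>X\<close> carries an arbitrary norm, which need not be the type-class norm of the
  underlying type.  The norm is therefore an explicit parameter \<open>N\<close>, and all topological notions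
  (interior, semicontinuity, dual space, boundedness, convergence) are taken with respect to \<open>N\<close>.
\<close>

definition is_norm :: "('a::real_vector \<Rightarrow> real) \<Rightarrow> bool" where
  "is_norm N \<longleftrightarrow>
     (\<forall>x. 0 \<le> N x) \<and> (\<forall>x. N x = 0 \<longleftrightarrow> x = 0) \<and>
     (\<forall>a x. N (a *\<^sub>R x) = \<bar>a\<bar> * N x) \<and> (\<forall>x y. N (x + y) \<le> N x + N y)"

definition norm_topology :: "('a::real_vector \<Rightarrow> real) \<Rightarrow> 'a topology" where
  "norm_topology N = Metric_space.mtopology UNIV (\<lambda>x y. N (x - y))"

definition norm_bounded :: "('a::real_vector \<Rightarrow> real) \<Rightarrow> 'a set \<Rightarrow> bool" where
  "norm_bounded N S \<longleftrightarrow> (\<exists>M. \<forall>x\<in>S. N x \<le> M)"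

definition norm_dual :: "('a::real_vector \<Rightarrow> real) \<Rightarrow> ('a \<Rightarrow> real) set" where
  "norm_dual N = {L. linear L \<and> continuous_map (norm_topology N) euclideanreal L}"

definition weakly_converges ::
    "('a::real_vector \<Rightarrow> real) \<Rightarrow> (nat \<Rightarrow> 'a) \<Rightarrow> 'a \<Rightarrow> bool" where
  "weakly_converges N ys y \<longleftrightarrow> (\<forall>L\<in>norm_dual N. (\<lambda>i. L (ys i)) \<longlonglongrightarrow> L y)"

subsection \<open>Extended-real-valued convex functions\<close>

definition eff_dom :: "('a \<Rightarrow> ereal) \<Rightarrow> 'a set" where
  "eff_dom b = {x. b x < \<infinity>}"

text \<open>Functions take values in \<open>(-\<infinity>, \<infinity>]\<close>; this is made part of convexity.\<close>

definition convex_fun :: "('a::real_vector \<Rightarrow> ereal) \<Rightarrow> bool" where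
  "convex_fun b \<longleftrightarrow> (\<forall>x. b x \<noteq> -\<infinity>) \<and>
     (\<forall>x y. \<forall>l\<in>{0<..<1::real}.
        b (l *\<^sub>R x + (1 - l) *\<^sub>R y) \<le> ereal l * b x + ereal (1 - l) * b y)"

definition strictly_convex_fun_on :: "'a::real_vector set \<Rightarrow> ('a \<Rightarrow> ereal) \<Rightarrow> bool" where
  "strictly_convex_fun_on S b \<longleftrightarrow>
     (\<forall>x\<in>S. \<forall>y\<in>S. x \<noteq> y \<longrightarrow> (\<forall>l\<in>{0<..<1::real}.
        b (l *\<^sub>R x + (1 - l) *\<^sub>R y) < ereal l * b x + ereal (1 - l) * b y))"

definition lower_semicont :: "('a::real_vector \<Rightarrow> real) \<Rightarrow> ('a \<Rightarrow> ereal) \<Rightarrow> bool" where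
  "lower_semicont N b \<longleftrightarrow> (\<forall>a::real. openin (norm_topology N) {x. ereal a < b x})"

text \<open>A gauge is a map \<open>[0,\<infinity>) \<rightarrow> [0,\<infinity>]\<close>; its values at negative arguments are irrelevant.\<close>

definition unif_convex_rel ::
    "('a::real_vector \<Rightarrow> real) \<Rightarrow> ('a \<Rightarrow> ereal) \<Rightarrow> 'a set \<Rightarrow> 'a set \<Rightarrow> (real \<Rightarrow> ereal) \<Rightarrow> bool" where
  "unif_convex_rel N b S1 S2 \<psi> \<longleftrightarrow>
     convex_fun b \<and> S1 \<noteq> {} \<and> S2 \<noteq> {} \<and> S1 \<subseteq> eff_dom b \<and> S2 \<subseteq> eff_dom b \<and>
     (\<forall>t\<ge>0. 0 \<le> \<psi> t) \<and> (\<forall>t>0. 0 < \<psi> t) \<and>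
     (\<forall>l\<in>{0<..<1::real}. \<forall>x\<in>S1. \<forall>y\<in>S2.
        b (l *\<^sub>R x + (1 - l) *\<^sub>R y) + ereal (l * (1 - l)) * \<psi> (N (x - y))
          \<le> ereal l * b x + ereal (1 - l) * b y)"

definition unif_convex_on ::
    "('a::real_vector \<Rightarrow> real) \<Rightarrow> ('a \<Rightarrow> ereal) \<Rightarrow> 'a set \<Rightarrow> bool" where
  "unif_convex_on N b S \<longleftrightarrow> (\<exists>\<psi>. unif_convex_rel N b S S \<psi>)"

definition strong_convexity_parameter ::
    "('a::real_vector \<Rightarrow> real) \<Rightarrow> ('a \<Rightarrow> ereal) \<Rightarrow> 'a set \<Rightarrow> real \<Rightarrow> bool" where
  "strong_convexity_parameter N b S \<mu> \<longleftrightarrow>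
     \<mu> > 0 \<and> unif_convex_rel N b S S (\<lambda>t. ereal (1 / 2 * \<mu> * t\<^sup>2))"

definition strong_convex_on ::
    "('a::real_vector \<Rightarrow> real) \<Rightarrow> ('a \<Rightarrow> ereal) \<Rightarrow> 'a set \<Rightarrow> bool" where
  "strong_convex_on N b S \<longleftrightarrow> (\<exists>\<mu>. strong_convexity_parameter N b S \<mu>)"

subsection \<open>Gateaux derivatives and the Bregman divergence\<close>

definition has_gateaux_deriv ::
    "('a::real_vector \<Rightarrow> real) \<Rightarrow> ('a \<Rightarrow> ereal) \<Rightarrow> 'a \<Rightarrow> ('a \<Rightarrow> real) \<Rightarrow> bool" where
  "has_gateaux_deriv N b y L \<longleftrightarrow> \<bar>b y\<bar> \<noteq> \<infinity> \<and> L \<in> norm_dual N \<and>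
     (\<forall>h. ((\<lambda>t::real. (b (y + t *\<^sub>R h) - b y) / ereal t) \<longlongrightarrow> ereal (L h)) (at 0))"

definition gateaux_deriv ::
    "('a::real_vector \<Rightarrow> real) \<Rightarrow> ('a \<Rightarrow> ereal) \<Rightarrow> 'a \<Rightarrow> ('a \<Rightarrow> real)" where
  "gateaux_deriv N b y = (THE L. has_gateaux_deriv N b y L)"

definition bregman_div ::
    "('a::real_vector \<Rightarrow> real) \<Rightarrow> ('a \<Rightarrow> ereal) \<Rightarrow> 'a set \<Rightarrow> 'a \<Rightarrow> 'a \<Rightarrow> ereal" where
  "bregman_div N b U x y =
     (if x \<in> eff_dom b \<and> y \<in> U then b x - b y - ereal (gateaux_deriv N b y (x - y)) else \<infinity>)"

definition bregman_function ::
    "('a::real_vector \<Rightarrow> real) \<Rightarrow> ('a \<Rightarrow> ereal) \<Rightarrow> 'a set \<Rightarrow> bool" where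
  "bregman_function N b U \<longleftrightarrow>
     (U = norm_topology N interior_of eff_dom b \<and> U \<noteq> {} \<and>
      (\<forall>y\<in>U. \<exists>L. has_gateaux_deriv N b y L)) \<and>
     (convex_fun b \<and> lower_semicont N b \<and> strictly_convex_fun_on (eff_dom b) b) \<and>
     (\<forall>\<gamma>::real. \<forall>x\<in>eff_dom b. norm_bounded N {y\<in>U. bregman_div N b U x y \<le> ereal \<gamma>}) \<and>
     (\<forall>x\<in>eff_dom b. \<forall>ys::nat \<Rightarrow> 'a. (\<forall>i. ys i \<in> U) \<longrightarrow> (\<lambda>i. N (x - ys i)) \<longlonglongrightarrow> 0 \<longrightarrow>
        (\<lambda>i. bregman_div N b U x (ys i)) \<longlonglongrightarrow> 0) \<and>
     (\<forall>(xs::nat \<Rightarrow> 'a) (ys::nat \<Rightarrow> 'a). \<forall>y\<in>eff_dom b.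
        (\<forall>i. xs i \<in> eff_dom b) \<longrightarrow> norm_bounded N (range xs) \<longrightarrow> (\<forall>i. ys i \<in> U) \<longrightarrow>
        (\<lambda>i. bregman_div N b U (xs i) (ys i)) \<longlonglongrightarrow> 0 \<longrightarrow> (\<lambda>i. N (ys i - y)) \<longlonglongrightarrow> 0 \<longrightarrow>
        (\<lambda>i. N (xs i - y)) \<longlonglongrightarrow> 0)"

definition limiting_difference_property ::
    "('a::real_vector \<Rightarrow> real) \<Rightarrow> ('a \<Rightarrow> ereal) \<Rightarrow> 'a set \<Rightarrow> bool" where
  "limiting_difference_property N b U \<longleftrightarrow>
     (\<forall>x\<in>eff_dom b. \<forall>ys::nat \<Rightarrow> 'a. \<forall>y\<in>U.
        (\<forall>i. ys i \<in> U) \<longrightarrow> weakly_converges N ys y \<longrightarrow>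
        (\<lambda>i. bregman_div N b U x (ys i) - bregman_div N b U y (ys i))
          \<longlonglongrightarrow> bregman_div N b U x y)"

definition sequentially_consistent ::
    "('a::real_vector \<Rightarrow> real) \<Rightarrow> ('a \<Rightarrow> ereal) \<Rightarrow> 'a set \<Rightarrow> bool" where
  "sequentially_consistent N b U \<longleftrightarrow>
     (\<forall>(xs::nat \<Rightarrow> 'a) (ys::nat \<Rightarrow> 'a).
        (\<forall>i. xs i \<in> eff_dom b) \<longrightarrow> (\<forall>i. ys i \<in> U) \<longrightarrow> norm_bounded N (range ys) \<longrightarrow>
        (\<lambda>i. bregman_div N b U (xs i) (ys i)) \<longlonglongrightarrow> 0 \<longrightarrow>
        (\<lambda>i. N (xs i - ys i)) \<longlonglongrightarrow> 0)"

subsection \<open>The negative Boltzmann--Gibbs--Shannon entropy\<close>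

definition pos_orthant :: "(real ^ 'n) set" where
  "pos_orthant = {x. \<forall>k. 0 < x $ k}"

definition nonneg_orthant :: "(real ^ 'n) set" where
  "nonneg_orthant = {x. \<forall>k. 0 \<le> x $ k}"

text \<open>The convention \<open>0 log 0 = 0\<close> holds automatically.\<close>

definition neg_entropy :: "real ^ 'n::finite \<Rightarrow> ereal" where
  "neg_entropy x =
     (if x \<in> nonneg_orthant then ereal (\<Sum>k\<in>UNIV. x $ k * ln (x $ k)) else \<infinity>)"

end

theory Submission
  imports Defs "HOL-Real_Asymp.Real_Asymp"
begin

text \<open>
  Everything rests on one scalar estimate.  For \<open>a \<ge> 0\<close> and \<open>c > 0\<close> let \<open>kl a c\<close> be the amount by
  which \<open>u \<mapsto> u ln u\<close> exceeds at \<open>a\<close> its tangent at \<open>c\<close>.  The second derivative \<open>1 / u\<close> is at least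
  \<open>1 / max a c\<close> between the two points, so \<open>kl a c \<ge> (a - c)\<^sup>2 / (2 max a c)\<close>
  (\<open>kl_ge_quadratic_max\<close>).  The entropy is a sum over coordinates, and its Bregman divergence is the
  sum of the scalar gaps (\<open>bregman_div_neg_entropy\<close>), so the estimate can be used in two ways.

  \<^item> Convexity.  A convexity gap is the weighted mean of two tangent gaps at the convex combination
    (\<open>kl_convex_combination\<close>).  Where all coordinates are at most \<open>m\<close> the entropy is therefore
    strongly convex with parameter \<open>1 / m\<close> in the Euclidean norm (\<open>entropy_sum_strong_convex\<close>), and
    the constants comparing the norms turn \<open>m = cinf * M\<close> into the parameter
    \<open>c2\<^sup>2 / (cinf * M)\<close> on the \<open>N\<close>-ball of radius \<open>M\<close>.  For the gauge that is linear in the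
    distance, take \<open>M = N w\<close>: as \<open>N w > 2 * N x\<close>, the distance \<open>t = N (x - w)\<close> exceeds
    \<open>N w / 2\<close>, so \<open>t\<^sup>2 / (2 * N w)\<close> dominates \<open>t / 4\<close>.

  \<^item> Divergence.  Since \<open>max a c \<le> p + \<bar>a - c\<bar>\<close> as soon as one of \<open>a\<close>, \<open>c\<close> is at most \<open>p\<close>, the
    estimate can be solved for \<open>\<bar>a - c\<bar>\<close>: the distance is bounded by a function of the divergence
    and \<open>p\<close> that vanishes with the divergence (\<open>abs_diff_le_kl\<close>).  This is symmetric in the two
    points and gives both kinds of bounded level sets as well as sequential consistency; the latter
    implies the last axiom of a Bregman function because a convergent sequence is bounded.

  Uniform convexity on the whole open orthant fails because \<open>1 / u\<close> tends to \<open>0\<close>: along the diagonal,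
  the convexity gap between two points at fixed distance tends to \<open>0\<close>.  The topological statements
  hold for \<open>N\<close> because it induces the Euclidean topology (\<open>norm_topology_eq\<close>).
\<close>

section \<open>The scalar divergence\<close>

text \<open>
  The Bregman divergence of \<open>u \<mapsto> u ln u\<close>, that is, a summand of the generalised Kullback--Leibler
  divergence.
\<close>

definition kl :: "real \<Rightarrow> real \<Rightarrow> real" where
  "kl a c = a * ln a - c * ln c - (1 + ln c) * (a - c)"

lemma kl_eq: "kl a c = a * ln a - a * ln c - a + c"
  by (simp add: kl_def algebra_simps)

lemma kl_0_left [simp]: "kl 0 c = c"
  by (simp add: kl_eq)

lemma kl_self [simp]: "kl a a = 0"
  by (simp add: kl_def)

text \<open>
  The difference of the two sides vanishes at \<open>a = c\<close>, and \<open>1 - 1 / t \<le> ln t \<le> t - 1\<close> shows that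
  its derivative in \<open>a\<close> is nonpositive below \<open>c\<close> and nonnegative above.
\<close>

lemma kl_ge_quadratic_max:
  assumes "0 \<le> a" "0 < c"
  shows "(a - c)\<^sup>2 / (2 * max a c) \<le> kl a c"
proof -
  define m where "m = max a c"
  have m: "m > 0" "a \<le> m" "c \<le> m" using assms by (auto simp: m_def)
  show ?thesis
  proof (cases "a = 0")
    case True
    then show ?thesis using assms by (simp add: power2_eq_square)
  next
    case False
    hence a: "a > 0" using assms by simp
    \<comment> \<open>The denominator \<open>m\<close> stays fixed while \<open>u\<close> moves between \<open>a\<close> and \<open>c\<close>.\<close>
    define g where "g = (\<lambda>u. kl u c - (u - c)\<^sup>2 / (2 * m))"
    have der: "(g has_real_derivative (ln u - ln c - (u - c) / m)) (at u)" if "u > 0" for u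
      unfolding g_def kl_eq using that m(1) assms
      by (auto intro!: derivative_eq_intros simp: field_simps)
    have gc: "g c = 0" by (simp add: g_def kl_def)
    have "0 \<le> g a"
    proof (cases "c \<le> a")
      case True
      have "g c \<le> g a"
      proof (rule DERIV_nonneg_imp_nondecreasing[OF True])
        fix u assume u: "c \<le> u" "u \<le> a"
        have "1 - c / u \<le> ln (u / c)"
          using ln_le_minus_one[of "c / u"] u assms by (simp add: ln_div)
        moreover have "(u - c) / m \<le> (u - c) / u"
          using u assms m by (intro divide_left_mono) auto
        moreover have "(u - c) / u = 1 - c / u"
          using u assms by (simp add: field_simps)
        ultimately have "0 \<le> ln u - ln c - (u - c) / m"
          using u assms by (simp add: ln_div)
        thus "\<exists>y. (g has_real_derivative y) (at u) \<and> 0 \<le> y" using der[of u] u assms by auto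
      qed
      with gc show ?thesis by simp
    next
      case False
      hence "a \<le> c" by simp
      have "g c \<le> g a"
      proof (rule DERIV_nonpos_imp_nonincreasing[OF \<open>a \<le> c\<close>])
        fix u assume u: "a \<le> u" "u \<le> c"
        have "ln (u / c) \<le> u / c - 1"
          using ln_le_minus_one[of "u / c"] u a assms by simp
        moreover have "u / c - 1 \<le> (u - c) / m"
        proof -
          have "(c - u) / m \<le> (c - u) / c"
            using u assms m by (intro divide_left_mono) auto
          thus ?thesis using assms m by (simp add: diff_divide_distrib)
        qed
        ultimately have "ln u - ln c - (u - c) / m \<le> 0"
          using u a assms by (simp add: ln_div)
        thus "\<exists>y. (g has_real_derivative y) (at u) \<and> y \<le> 0" using der[of u] u a by auto
      qed
      with gc show ?thesis by simp
    qed
    thus ?thesis by (simp add: g_def m_def)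
  qed
qed

lemma kl_ge_quadratic:
  assumes "0 \<le> a" "0 < c" "a \<le> m" "c \<le> m"
  shows "(a - c)\<^sup>2 / (2 * m) \<le> kl a c"
proof -
  have "(a - c)\<^sup>2 / (2 * m) \<le> (a - c)\<^sup>2 / (2 * max a c)"
    using assms by (intro divide_left_mono) auto
  thus ?thesis using kl_ge_quadratic_max[OF assms(1,2)] by linarith
qed

lemma kl_nonneg: "0 \<le> a \<Longrightarrow> 0 < c \<Longrightarrow> 0 \<le> kl a c"
  using kl_ge_quadratic[of a c "max a c"] by (smt (verit) divide_nonneg_pos zero_le_power2)

lemma kl_le_quadratic:
  assumes "0 < a" "0 < c"
  shows "kl a c \<le> (a - c)\<^sup>2 / c"
proof -
  have "a * ln (a / c) \<le> a * (a / c - 1)"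
    using assms ln_le_minus_one[of "a / c"] by (intro mult_left_mono) auto
  thus ?thesis using assms by (simp add: kl_eq ln_div field_simps power2_eq_square)
qed

text \<open>
  The quadratic lower bound, solved for the distance.  The bound \<open>p\<close> may be for either argument,
  which is why the divergence controls the distance in both arguments.
\<close>

lemma abs_diff_le_kl:
  assumes "0 \<le> a" "0 < c" "kl a c \<le> d" "a \<le> p \<or> c \<le> p"
  shows "\<bar>a - c\<bar> \<le> d + sqrt (d\<^sup>2 + 2 * d * p)"
proof -
  define r where "r = \<bar>a - c\<bar>"
  have d: "0 \<le> d" using kl_nonneg[OF assms(1,2)] assms(3) by simp
  have M: "0 < max a c" "max a c \<le> p + r" using assms by (auto simp: r_def)
  have "r\<^sup>2 / (2 * max a c) \<le> d"
    using kl_ge_quadratic_max[OF assms(1,2)] assms(3) by (simp add: r_def)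
  hence "r\<^sup>2 \<le> d * (2 * max a c)" using M(1) by (simp add: pos_divide_le_eq)
  also have "\<dots> \<le> d * (2 * (p + r))" using M(2) d by (intro mult_left_mono) auto
  finally have "(r - d)\<^sup>2 \<le> d\<^sup>2 + 2 * d * p" by (simp add: power2_eq_square algebra_simps)
  hence "r - d \<le> sqrt (d\<^sup>2 + 2 * d * p)" by (rule real_le_rsqrt)
  thus ?thesis by (simp add: r_def)
qed

text \<open>
  At \<open>a = 0\<close> the logarithm is discontinuous, but there the divergence is simply its second argument.
\<close>

lemma tendsto_kl:
  assumes "0 \<le> a" "(c \<longlongrightarrow> a) F"
  shows "((\<lambda>i. kl a (c i)) \<longlongrightarrow> 0) F"
proof (cases "a = 0")
  case True
  then show ?thesis using assms by simp
next
  case False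
  have "((\<lambda>i. kl a (c i)) \<longlongrightarrow> kl a a) F"
    unfolding kl_def using assms False by (intro tendsto_intros) auto
  thus ?thesis by (simp add: kl_def)
qed

text \<open>The tangent terms cancel because \<open>c\<close> is the weighted mean of \<open>a\<close> and \<open>b\<close>.\<close>

lemma kl_convex_combination:
  assumes "c = l * a + (1 - l) * b"
  shows "l * (a * ln a) + (1 - l) * (b * ln b) - c * ln c = l * kl a c + (1 - l) * kl b c"
proof -
  have "l * kl a c + (1 - l) * kl b c =
      l * (a * ln a) + (1 - l) * (b * ln b) - c * ln c
      - (1 + ln c) * (l * a + (1 - l) * b - c)"
    by (simp add: kl_def algebra_simps)
  thus ?thesis using assms by simp
qed

text \<open>
  Comparing with the tangent at the convex combination \<open>c\<close> instead of using second derivatives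
  admits endpoints at \<open>0\<close>: only \<open>c\<close> must be positive, and \<open>c = 0\<close> forces both terms of the
  combination to vanish.
\<close>

lemma xlnx_strong_convex:
  fixes a b l m :: real
  assumes "0 \<le> a" "0 \<le> b" "a \<le> m" "b \<le> m" "0 < l" "l < 1"
  defines "c \<equiv> l * a + (1 - l) * b"
  shows "c * ln c + l * (1 - l) / (2 * m) * (a - b)\<^sup>2 \<le> l * (a * ln a) + (1 - l) * (b * ln b)"
proof (cases "c = 0")
  case True
  have "l * a \<ge> 0" "(1 - l) * b \<ge> 0" using assms by auto
  hence "l * a = 0" "(1 - l) * b = 0" using True unfolding c_def by linarith+
  then show ?thesis using assms True by simp
next
  case False
  have c0: "0 < c" using False assms by (simp add: less_le)
  have cm: "c \<le> m" unfolding c_def using assms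
    by (intro convex_bound_le) auto
  have "l * ((a - c)\<^sup>2 / (2 * m)) + (1 - l) * ((b - c)\<^sup>2 / (2 * m)) \<le> l * kl a c + (1 - l) * kl b c"
    using assms c0 cm by (intro add_mono mult_left_mono kl_ge_quadratic) auto
  also have "l * ((a - c)\<^sup>2 / (2 * m)) + (1 - l) * ((b - c)\<^sup>2 / (2 * m)) =
      (l * (a - c)\<^sup>2 + (1 - l) * (b - c)\<^sup>2) / (2 * m)"
    by (simp add: add_divide_distrib)
  also have "l * (a - c)\<^sup>2 + (1 - l) * (b - c)\<^sup>2 = l * (1 - l) * (a - b)\<^sup>2"
    unfolding c_def by (simp add: power2_eq_square algebra_simps)
  finally show ?thesis using kl_convex_combination[of c l a b] by (simp add: c_def)
qed

lemma continuous_on_xlnx: "continuous_on {0..} (\<lambda>u::real. u * ln u)"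
  unfolding continuous_on_def
proof
  fix u :: real assume u: "u \<in> {0..}"
  show "((\<lambda>u. u * ln u) \<longlongrightarrow> u * ln u) (at u within {0..})"
  proof (cases "u = 0")
    case True
    have "((\<lambda>u::real. u * ln u) \<longlongrightarrow> 0) (at_right 0)" by real_asymp
    with True show ?thesis by (simp add: at_within_Ici_at_right)
  next
    case False
    with u show ?thesis by (intro tendsto_intros) auto
  qed
qed

section \<open>The entropy on coordinate space\<close>

definition entropy_sum :: "real ^ 'n::finite \<Rightarrow> real" where
  "entropy_sum x = (\<Sum>k\<in>UNIV. x $ k * ln (x $ k))"

definition kl_sum :: "real ^ 'n::finite \<Rightarrow> real ^ 'n \<Rightarrow> real" where
  "kl_sum x y = (\<Sum>k\<in>UNIV. kl (x $ k) (y $ k))"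

lemma neg_entropy_nonneg: "x \<in> nonneg_orthant \<Longrightarrow> neg_entropy x = ereal (entropy_sum x)"
  by (simp add: neg_entropy_def entropy_sum_def)

lemma eff_dom_neg_entropy: "eff_dom neg_entropy = nonneg_orthant"
  by (auto simp: eff_dom_def neg_entropy_def)

lemma pos_subset_nonneg: "pos_orthant \<subseteq> nonneg_orthant"
  by (auto simp: pos_orthant_def nonneg_orthant_def less_imp_le)

lemma convex_nonneg_orthant: "convex nonneg_orthant"
  by (auto simp: convex_def nonneg_orthant_def)

lemma nonneg_orthant_segment:
  assumes "x \<in> nonneg_orthant" "y \<in> nonneg_orthant" "0 < l" "l < 1"
  shows "l *\<^sub>R x + (1 - l) *\<^sub>R y \<in> nonneg_orthant"
  using convexD[OF convex_nonneg_orthant assms(1,2), of l "1 - l"] assms by simp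

lemma open_pos_orthant: "open (pos_orthant :: (real ^ 'n::finite) set)"
proof -
  have *: "pos_orthant = (\<Inter>k\<in>UNIV. {x::real^'n. 0 < x $ k})" by (auto simp: pos_orthant_def)
  show ?thesis unfolding * by (intro open_INT finite ballI open_Collect_less continuous_intros)
qed

lemma closed_nonneg_orthant: "closed (nonneg_orthant :: (real ^ 'n::finite) set)"
proof -
  have *: "nonneg_orthant = (\<Inter>k\<in>UNIV. {x::real^'n. 0 \<le> x $ k})" by (auto simp: nonneg_orthant_def)
  show ?thesis unfolding * by (intro closed_INT ballI closed_Collect_le continuous_intros)
qed

text \<open>A ball around a point with a zero coordinate leaves the orthant along that axis.\<close>

lemma interior_nonneg_orthant: "interior nonneg_orthant = pos_orthant"
proof
  show "interior nonneg_orthant \<subseteq> (pos_orthant :: (real^'n) set)"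
  proof
    fix x :: "real^'n" assume "x \<in> interior nonneg_orthant"
    then obtain e where e: "e > 0" "cball x e \<subseteq> nonneg_orthant"
      by (auto simp: mem_interior_cball)
    show "x \<in> pos_orthant"
      unfolding pos_orthant_def
    proof safe
      fix k
      have "x - e *\<^sub>R axis k 1 \<in> cball x e" using e(1) by (simp add: dist_norm)
      with e(2) have "x - e *\<^sub>R axis k 1 \<in> nonneg_orthant" by blast
      hence "0 \<le> (x - e *\<^sub>R axis k 1) $ k" unfolding nonneg_orthant_def by blast
      thus "0 < x $ k" using e(1) by simp
    qed
  qed
qed (intro interior_maximal pos_subset_nonneg open_pos_orthant)

lemma continuous_on_entropy_sum: "continuous_on nonneg_orthant entropy_sum"
  unfolding entropy_sum_def
  by (intro continuous_on_sum continuous_on_compose2[OF continuous_on_xlnx])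
     (auto intro!: continuous_intros simp: nonneg_orthant_def)

lemma entropy_sum_strong_convex:
  fixes x y :: "real ^ 'n::finite"
  assumes "x \<in> nonneg_orthant" "y \<in> nonneg_orthant" "infnorm x \<le> m" "infnorm y \<le> m"
    and "0 < l" "l < 1"
  shows "entropy_sum (l *\<^sub>R x + (1 - l) *\<^sub>R y) + l * (1 - l) / (2 * m) * (norm (x - y))\<^sup>2
     \<le> l * entropy_sum x + (1 - l) * entropy_sum y"
proof -
  have le: "z $ k \<le> m" if "infnorm z \<le> m" for z :: "real^'n" and k
    using component_le_infnorm_cart[of z k] that by linarith
  have sq: "(norm (x - y))\<^sup>2 = (\<Sum>k\<in>UNIV. (x $ k - y $ k)\<^sup>2)"
    by (simp add: norm_vec_def L2_set_def sum_nonneg)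
  have "entropy_sum (l *\<^sub>R x + (1 - l) *\<^sub>R y) + l * (1 - l) / (2 * m) * (norm (x - y))\<^sup>2 =
     (\<Sum>k\<in>UNIV. (l * x $ k + (1 - l) * y $ k) * ln (l * x $ k + (1 - l) * y $ k)
        + l * (1 - l) / (2 * m) * (x $ k - y $ k)\<^sup>2)"
    unfolding sq sum_distrib_left by (simp add: entropy_sum_def sum.distrib)
  also have "\<dots> \<le> (\<Sum>k\<in>UNIV. l * (x $ k * ln (x $ k)) + (1 - l) * (y $ k * ln (y $ k)))"
    using assms le by (intro sum_mono xlnx_strong_convex) (auto simp: nonneg_orthant_def)
  also have "\<dots> = l * entropy_sum x + (1 - l) * entropy_sum y"
    by (simp add: entropy_sum_def sum.distrib sum_distrib_left)
  finally show ?thesis .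
qed

lemma convex_fun_neg_entropy: "convex_fun (neg_entropy :: real ^ 'n::finite \<Rightarrow> ereal)"
  unfolding convex_fun_def
proof (intro conjI allI ballI)
  fix x y :: "real^'n" and l :: real
  assume l: "l \<in> {0<..<1}"
  show "neg_entropy (l *\<^sub>R x + (1 - l) *\<^sub>R y) \<le> ereal l * neg_entropy x + ereal (1 - l) * neg_entropy y"
  proof (cases "x \<in> nonneg_orthant \<and> y \<in> nonneg_orthant")
    case True
    define m where "m = max (infnorm x) (infnorm y)"
    have "0 \<le> l * (1 - l) / (2 * m) * (norm (x - y))\<^sup>2"
      using l by (auto simp: m_def infnorm_pos_le le_max_iff_disj)
    hence "entropy_sum (l *\<^sub>R x + (1 - l) *\<^sub>R y) \<le> l * entropy_sum x + (1 - l) * entropy_sum y"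
      using entropy_sum_strong_convex[of x y m l] True l by (auto simp: m_def)
    thus ?thesis using True l by (simp add: neg_entropy_nonneg nonneg_orthant_segment)
  next
    case False
    thus ?thesis using l by (auto simp: neg_entropy_def)
  qed
qed (simp add: neg_entropy_def)

lemma strictly_convex_neg_entropy:
  "strictly_convex_fun_on nonneg_orthant (neg_entropy :: real ^ 'n::finite \<Rightarrow> ereal)"
  unfolding strictly_convex_fun_on_def
proof (intro ballI impI)
  fix x y :: "real^'n" and l :: real
  assume x: "x \<in> nonneg_orthant" and y: "y \<in> nonneg_orthant" and "x \<noteq> y" and l: "l \<in> {0<..<1}"
  define m where "m = max (infnorm x) (infnorm y)"
  have "m > 0" using \<open>x \<noteq> y\<close> infnorm_pos_lt[of x] infnorm_pos_lt[of y]
    by (cases "x = 0") (auto simp: m_def less_max_iff_disj)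
  hence "0 < l * (1 - l) / (2 * m) * (norm (x - y))\<^sup>2"
    using l \<open>x \<noteq> y\<close> by auto
  hence "entropy_sum (l *\<^sub>R x + (1 - l) *\<^sub>R y) < l * entropy_sum x + (1 - l) * entropy_sum y"
    using entropy_sum_strong_convex[of x y m l] x y l by (auto simp: m_def)
  thus "neg_entropy (l *\<^sub>R x + (1 - l) *\<^sub>R y) < ereal l * neg_entropy x + ereal (1 - l) * neg_entropy y"
    using x y l by (simp add: neg_entropy_nonneg nonneg_orthant_segment)
qed

text \<open>
  The complement is a sublevel set of a function that is continuous on the closed orthant, the jump
  to \<open>\<infinity>\<close> outside being in the right direction.
\<close>

lemma open_superlevel_neg_entropy:
  "open {x::real ^ 'n::finite. ereal a < neg_entropy x}"
proof -
  have "closed {x::real^'n. x \<in> nonneg_orthant \<and> entropy_sum x \<le> a}"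
    by (intro continuous_on_closed_Collect_le continuous_on_entropy_sum
        continuous_on_const closed_nonneg_orthant)
  moreover have "{x. ereal a < neg_entropy x} = - {x::real^'n. x \<in> nonneg_orthant \<and> entropy_sum x \<le> a}"
    by (auto simp: neg_entropy_def entropy_sum_def)
  ultimately show ?thesis by (simp only: open_Compl)
qed

lemma kl_sum_nonneg:
  assumes "x \<in> nonneg_orthant" "y \<in> pos_orthant"
  shows "0 \<le> kl_sum x y"
  unfolding kl_sum_def using assms
  by (intro sum_nonneg kl_nonneg) (auto simp: nonneg_orthant_def pos_orthant_def)

lemma kl_le_kl_sum:
  assumes "x \<in> nonneg_orthant" "y \<in> pos_orthant"
  shows "kl (x $ k) (y $ k) \<le> kl_sum x y"
  unfolding kl_sum_def using assms
  by (intro member_le_sum kl_nonneg) (auto simp: nonneg_orthant_def pos_orthant_def)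

lemma infnorm_diff_le_kl_sum:
  fixes x y :: "real ^ 'n::finite"
  assumes "x \<in> nonneg_orthant" "y \<in> pos_orthant" "kl_sum x y \<le> d" "infnorm x \<le> p \<or> infnorm y \<le> p"
  shows "infnorm (x - y) \<le> d + sqrt (d\<^sup>2 + 2 * d * p)"
proof -
  have "\<bar>(x - y) $ k\<bar> \<le> d + sqrt (d\<^sup>2 + 2 * d * p)" for k
  proof -
    have "x $ k \<le> p \<or> y $ k \<le> p"
      using component_le_infnorm_cart[of x k] component_le_infnorm_cart[of y k] assms(4)
      by linarith
    moreover have "kl (x $ k) (y $ k) \<le> d"
      using kl_le_kl_sum[OF assms(1,2), of k] assms(3) by linarith
    ultimately show ?thesis
      using abs_diff_le_kl[of "x $ k" "y $ k" d p] assms(1,2)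
      by (auto simp: nonneg_orthant_def pos_orthant_def)
  qed
  thus ?thesis by (auto simp: infnorm_cart intro!: cSup_least)
qed

section \<open>An arbitrary norm on coordinate space\<close>

locale coordinate_norm =
  fixes N :: "real ^ 'n::finite \<Rightarrow> real" and c2 cinf :: real
  assumes is_norm: "is_norm N"
    and c2_pos: "c2 > 0" and cinf_pos: "cinf > 0"
    and c2_le: "\<And>v. c2 * N v \<le> norm v"
    and infnorm_le: "\<And>v. infnorm v \<le> cinf * N v"
begin

lemma N_nonneg: "0 \<le> N x" and N_zero_iff: "N x = 0 \<longleftrightarrow> x = 0"
  and N_scale: "N (a *\<^sub>R x) = \<bar>a\<bar> * N x" and N_triangle: "N (x + y) \<le> N x + N y"
  using is_norm by (auto simp: is_norm_def)

lemma N_minus_commute: "N (x - y) = N (y - x)"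
  using N_scale[of "-1" "x - y"] by simp

lemma N_le: "N v \<le> norm v / c2"
  using c2_le[of v] c2_pos by (simp add: field_simps)

definition norm_factor :: real where "norm_factor = sqrt DIM(real^'n) * cinf"

lemma norm_factor_pos: "norm_factor > 0"
  using cinf_pos by (simp add: norm_factor_def)

lemma norm_le: "norm v \<le> norm_factor * N v"
proof -
  have "norm v \<le> sqrt DIM(real^'n) * infnorm v" by (rule norm_le_infnorm)
  also have "\<dots> \<le> sqrt DIM(real^'n) * (cinf * N v)" by (intro mult_left_mono infnorm_le) auto
  finally show ?thesis by (simp add: norm_factor_def mult.assoc)
qed

lemma norm_bounded_iff: "norm_bounded N S \<longleftrightarrow> bounded S"
proof
  assume "norm_bounded N S"
  then obtain M where M: "\<forall>x\<in>S. N x \<le> M" by (auto simp: norm_bounded_def)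
  have "norm x \<le> norm_factor * M" if "x \<in> S" for x
    using norm_le[of x] M that norm_factor_pos by (meson mult_left_mono order_trans less_imp_le)
  thus "bounded S" by (auto simp: bounded_iff)
next
  assume "bounded S"
  then obtain M where M: "\<forall>x\<in>S. norm x \<le> M" by (auto simp: bounded_iff)
  have "N x \<le> M / c2" if "x \<in> S" for x
    using N_le[of x] M that c2_pos by (meson divide_right_mono order_trans less_imp_le)
  thus "norm_bounded N S" by (auto simp: norm_bounded_def)
qed

lemma N_tendsto_zero_iff: "((\<lambda>i. N (f i)) \<longlongrightarrow> 0) F \<longleftrightarrow> (f \<longlongrightarrow> 0) F"
proof
  assume *: "((\<lambda>i. N (f i)) \<longlongrightarrow> 0) F"
  have "((\<lambda>i. norm_factor * N (f i)) \<longlongrightarrow> 0) F" using tendsto_mult_right_zero[OF *] .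
  thus "(f \<longlongrightarrow> 0) F"
    by (rule Lim_null_comparison[rotated]) (simp add: norm_le)
next
  assume "(f \<longlongrightarrow> 0) F"
  hence "((\<lambda>i. norm (f i) / c2) \<longlongrightarrow> 0) F"
    using tendsto_divide_zero tendsto_norm_zero by blast
  thus "((\<lambda>i. N (f i)) \<longlongrightarrow> 0) F"
    by (rule Lim_null_comparison[rotated]) (simp add: N_nonneg N_le)
qed

lemma N_tendsto_iff: "((\<lambda>i. N (f i - y)) \<longlongrightarrow> 0) F \<longleftrightarrow> (f \<longlongrightarrow> y) F"
  using N_tendsto_zero_iff[of "\<lambda>i. f i - y"] LIM_zero_iff by blast

lemma norm_topology_eq: "norm_topology N = euclidean"
proof -
  interpret M: Metric_space UNIV "\<lambda>x y. N (x - y)"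
  proof
    fix x y z :: "real^'n"
    show "N (x - z) \<le> N (x - y) + N (y - z)" using N_triangle[of "x - y" "y - z"] by simp
  qed (auto simp: N_nonneg N_zero_iff N_minus_commute)
  have "openin M.mtopology S \<longleftrightarrow> open S" for S
  proof
    assume S: "openin M.mtopology S"
    show "open S" unfolding open_contains_ball
    proof
      fix x assume "x \<in> S"
      then obtain r where r: "r > 0" "M.mball x r \<subseteq> S" using S by (auto simp: M.openin_mtopology)
      have "ball x (c2 * r) \<subseteq> M.mball x r"
      proof
        fix z assume "z \<in> ball x (c2 * r)"
        hence "c2 * N (x - z) < c2 * r" using c2_le[of "x - z"] by (simp add: dist_norm)
        thus "z \<in> M.mball x r" using c2_pos by simp
      qed
      thus "\<exists>e>0. ball x e \<subseteq> S" using r c2_pos by (intro exI[of _ "c2 * r"]) auto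
    qed
  next
    assume S: "open S"
    show "openin M.mtopology S" unfolding M.openin_mtopology
    proof (intro conjI allI impI)
      fix x assume "x \<in> S"
      then obtain e where e: "e > 0" "ball x e \<subseteq> S" using S by (auto simp: open_contains_ball)
      have "M.mball x (e / norm_factor) \<subseteq> ball x e"
      proof
        fix z assume "z \<in> M.mball x (e / norm_factor)"
        hence "norm_factor * N (x - z) < e" using norm_factor_pos by (simp add: field_simps)
        thus "z \<in> ball x e" using norm_le[of "x - z"] by (simp add: dist_norm)
      qed
      thus "\<exists>r>0. M.mball x r \<subseteq> S" using e norm_factor_pos by (intro exI[of _ "e / norm_factor"]) auto
    qed simp
  qed
  thus ?thesis unfolding norm_topology_def by (simp add: topology_eq)
qed

lemma linear_in_norm_dual: "linear L \<Longrightarrow> L \<in> norm_dual N"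
  unfolding norm_dual_def norm_topology_eq
  by (auto simp: continuous_map_iff_continuous2 linear_continuous_on linear_conv_bounded_linear)

text \<open>Coordinate projections belong to the dual space.\<close>

lemma weakly_converges_imp_tendsto:
  assumes "weakly_converges N ys y"
  shows "(\<lambda>i. ys i $ k) \<longlonglongrightarrow> y $ k"
proof -
  have "(\<lambda>v::real^'n. v $ k) \<in> norm_dual N"
    by (intro linear_in_norm_dual) (auto simp: linear_iff)
  from bspec[OF assms[unfolded weakly_converges_def] this] show ?thesis .
qed

section \<open>The Bregman divergence of the entropy\<close>

lemma has_gateaux_deriv_neg_entropy:
  assumes y: "y \<in> pos_orthant"
  shows "has_gateaux_deriv N neg_entropy y (\<lambda>h. \<Sum>k\<in>UNIV. (1 + ln (y $ k)) * h $ k)"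
  unfolding has_gateaux_deriv_def
proof (intro conjI allI)
  have yn: "y \<in> nonneg_orthant" using y pos_subset_nonneg by blast
  show "\<bar>neg_entropy y\<bar> \<noteq> \<infinity>" using yn by (simp add: neg_entropy_nonneg)
  show "(\<lambda>h. \<Sum>k\<in>UNIV. (1 + ln (y $ k)) * h $ k) \<in> norm_dual N"
    by (intro linear_in_norm_dual)
       (auto simp: linear_iff algebra_simps sum.distrib sum_distrib_left)
  fix h
  define D where "D = (\<Sum>k\<in>UNIV. (1 + ln (y $ k)) * h $ k)"
  have yk: "y $ k > 0" for k using y by (simp add: pos_orthant_def)
  have "((\<lambda>t. entropy_sum (y + t *\<^sub>R h)) has_real_derivative D) (at 0)"
    unfolding entropy_sum_def D_def
  proof (rule DERIV_sum)
    fix k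
    show "((\<lambda>t. (y + t *\<^sub>R h) $ k * ln ((y + t *\<^sub>R h) $ k)) has_real_derivative
        (1 + ln (y $ k)) * h $ k) (at 0)"
      using yk[of k] by (auto intro!: derivative_eq_intros simp: algebra_simps)
  qed
  hence "((\<lambda>t. (entropy_sum (y + t *\<^sub>R h) - entropy_sum y) / t) \<longlongrightarrow> D) (at 0)"
    by (simp add: DERIV_def)
  hence lim: "((\<lambda>t. ereal ((entropy_sum (y + t *\<^sub>R h) - entropy_sum y) / t)) \<longlongrightarrow> ereal D) (at 0)"
    by simp
  have "((\<lambda>t. y + t *\<^sub>R h) \<longlongrightarrow> y + 0 *\<^sub>R h) (at 0)" by (intro tendsto_intros)
  hence "\<forall>\<^sub>F t in at 0. y + t *\<^sub>R h \<in> pos_orthant"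
    using topological_tendstoD open_pos_orthant y by fastforce
  hence "\<forall>\<^sub>F t in at 0. ereal ((entropy_sum (y + t *\<^sub>R h) - entropy_sum y) / t)
      = (neg_entropy (y + t *\<^sub>R h) - neg_entropy y) / ereal t"
    using eventually_neq_at_within[of 0 0 UNIV]
  proof eventually_elim
    case (elim t)
    hence "y + t *\<^sub>R h \<in> nonneg_orthant" using pos_subset_nonneg by blast
    thus ?case using yn elim by (simp add: neg_entropy_nonneg)
  qed
  from Lim_transform_eventually[OF lim this]
  show "((\<lambda>t. (neg_entropy (y + t *\<^sub>R h) - neg_entropy y) / ereal t) \<longlongrightarrow>
      ereal (\<Sum>k\<in>UNIV. (1 + ln (y $ k)) * h $ k)) (at 0)" by (simp add: D_def)
qed

lemma gateaux_deriv_neg_entropy: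
  assumes "y \<in> pos_orthant"
  shows "gateaux_deriv N neg_entropy y = (\<lambda>h. \<Sum>k\<in>UNIV. (1 + ln (y $ k)) * h $ k)"
  unfolding gateaux_deriv_def
proof (rule the_equality[where P = "has_gateaux_deriv N neg_entropy y"])
  show *: "has_gateaux_deriv N neg_entropy y (\<lambda>h. \<Sum>k\<in>UNIV. (1 + ln (y $ k)) * h $ k)"
    by (rule has_gateaux_deriv_neg_entropy[OF assms])
  fix L assume L: "has_gateaux_deriv N neg_entropy y L"
  show "L = (\<lambda>h. \<Sum>k\<in>UNIV. (1 + ln (y $ k)) * h $ k)"
  proof
    fix h
    have "ereal (L h) = ereal (\<Sum>k\<in>UNIV. (1 + ln (y $ k)) * h $ k)"
      using L * tendsto_unique[of "at (0::real)"] unfolding has_gateaux_deriv_def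
      by (metis (no_types, lifting) trivial_limit_at)
    thus "L h = (\<Sum>k\<in>UNIV. (1 + ln (y $ k)) * h $ k)" by simp
  qed
qed

lemma bregman_div_neg_entropy:
  assumes "x \<in> nonneg_orthant" "y \<in> pos_orthant"
  shows "bregman_div N neg_entropy pos_orthant x y = ereal (kl_sum x y)"
proof -
  have "y \<in> nonneg_orthant" using assms pos_subset_nonneg by blast
  thus ?thesis using assms
    by (simp add: bregman_div_def eff_dom_neg_entropy gateaux_deriv_neg_entropy neg_entropy_nonneg
        entropy_sum_def kl_sum_def kl_def sum_subtractf)
qed

lemma infnorm_le_of_N_le: "N x \<le> M \<Longrightarrow> infnorm x \<le> cinf * M"
  using infnorm_le[of x] cinf_pos by (meson mult_left_mono order_trans less_imp_le)

lemma c2_N_sq_le: "c2\<^sup>2 * (N v)\<^sup>2 \<le> (norm v)\<^sup>2"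
  using power_mono[OF c2_le[of v], of 2] c2_pos N_nonneg[of v] by (simp add: power_mult_distrib)

lemma neg_entropy_N_strong_convex:
  assumes x: "x \<in> nonneg_orthant" and y: "y \<in> nonneg_orthant"
    and M: "N x \<le> M" "N y \<le> M" "0 < M" and l: "0 < l" "l < 1"
  shows "neg_entropy (l *\<^sub>R x + (1 - l) *\<^sub>R y)
      + ereal (l * (1 - l)) * ereal (1 / 2 * (c2\<^sup>2 / (cinf * M)) * (N (x - y))\<^sup>2)
    \<le> ereal l * neg_entropy x + ereal (1 - l) * neg_entropy y"
proof -
  have "l * (1 - l) * (1 / 2 * (c2\<^sup>2 / (cinf * M)) * (N (x - y))\<^sup>2)
      = l * (1 - l) / (2 * (cinf * M)) * (c2\<^sup>2 * (N (x - y))\<^sup>2)"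
    by simp
  also have "\<dots> \<le> l * (1 - l) / (2 * (cinf * M)) * (norm (x - y))\<^sup>2"
    using l M cinf_pos by (intro mult_left_mono c2_N_sq_le) auto
  finally have "entropy_sum (l *\<^sub>R x + (1 - l) *\<^sub>R y)
      + l * (1 - l) * (1 / 2 * (c2\<^sup>2 / (cinf * M)) * (N (x - y))\<^sup>2)
      \<le> l * entropy_sum x + (1 - l) * entropy_sum y"
    using entropy_sum_strong_convex[OF x y infnorm_le_of_N_le[OF M(1)] infnorm_le_of_N_le[OF M(2)] l]
    by linarith
  thus ?thesis using x y l by (simp add: neg_entropy_nonneg nonneg_orthant_segment)
qed

lemma strong_convexity_parameter_neg_entropy:
  assumes "S \<noteq> {}" "S \<subseteq> nonneg_orthant" "0 < M" "\<And>s. s \<in> S \<Longrightarrow> N s \<le> M"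
  shows "strong_convexity_parameter N neg_entropy S (c2\<^sup>2 / (cinf * M))"
  unfolding strong_convexity_parameter_def unif_convex_rel_def
proof (intro conjI ballI allI impI)
  fix l x y assume "l \<in> {0<..<1::real}" "x \<in> S" "y \<in> S"
  thus "neg_entropy (l *\<^sub>R x + (1 - l) *\<^sub>R y)
      + ereal (l * (1 - l)) * ereal (1 / 2 * (c2\<^sup>2 / (cinf * M)) * (N (x - y))\<^sup>2)
    \<le> ereal l * neg_entropy x + ereal (1 - l) * neg_entropy y"
    using assms by (intro neg_entropy_N_strong_convex) auto
qed (use assms c2_pos cinf_pos in \<open>auto simp: eff_dom_neg_entropy convex_fun_neg_entropy\<close>)

lemma strong_convex_on_neg_entropy:
  assumes "S \<noteq> {}" "S \<subseteq> nonneg_orthant" "norm_bounded N S"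
  shows "strong_convex_on N neg_entropy S"
proof -
  obtain M where M: "\<forall>s\<in>S. N s \<le> M" using assms by (auto simp: norm_bounded_def)
  have "strong_convexity_parameter N neg_entropy S (c2\<^sup>2 / (cinf * (\<bar>M\<bar> + 1)))"
    using assms M by (intro strong_convexity_parameter_neg_entropy) fastforce+
  thus ?thesis unfolding strong_convex_on_def by blast
qed

lemma N_one_pos: "N 1 > 0"
  using N_nonneg[of 1] N_zero_iff[of 1] by (auto simp: less_le)

text \<open>
  Strong convexity on the ball of radius \<open>N w\<close> gives the gain \<open>t\<^sup>2 / (2 * N w)\<close> at distance
  \<open>t = N (x - w)\<close>, up to the constant \<open>c2\<^sup>2 / cinf\<close>.  As \<open>w\<close> is far from \<open>x\<close>, this distance satisfies
  \<open>N w \<le> 2 * t\<close>, and the parameter decaying with \<open>N w\<close> costs one power of \<open>t\<close> only.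
\<close>

lemma unif_convex_rel_neg_entropy_far:
  assumes x: "x \<in> nonneg_orthant"
  shows "unif_convex_rel N neg_entropy {x} (pos_orthant \<inter> {w. N w > 2 * N x})
           (\<lambda>t. ereal (c2\<^sup>2 / (4 * cinf) * t))"
  unfolding unif_convex_rel_def
proof (intro conjI ballI allI impI)
  \<comment> \<open>A multiple of \<open>1\<close> whose norm is \<open>2 * N x + N 1\<close>, so that the second set is nonempty.\<close>
  define r where "r = 2 * N x / N 1 + 1"
  have r: "r > 0" using N_nonneg[of x] N_one_pos by (auto simp: r_def intro: add_nonneg_pos)
  have "N (r *\<^sub>R 1) = 2 * N x + N 1" using r N_one_pos by (simp add: N_scale) (simp add: r_def field_simps)
  hence "r *\<^sub>R 1 \<in> pos_orthant \<inter> {w. N w > 2 * N x}"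
    using r N_one_pos by (simp add: pos_orthant_def)
  thus "pos_orthant \<inter> {w. N w > 2 * N x} \<noteq> {}" by blast
next
  fix l z w assume l: "l \<in> {0<..<1::real}" and "z \<in> {x}" and w: "w \<in> pos_orthant \<inter> {w. N w > 2 * N x}"
  hence [simp]: "z = x" by simp
  have wn: "w \<in> nonneg_orthant" using w pos_subset_nonneg by blast
  have Nw: "2 * N x < N w" "0 < N w" using w N_nonneg[of x] by auto
  define t where "t = N (x - w)"
  have "N w \<le> N x + N (w - x)" using N_triangle[of x "w - x"] by simp
  hence t: "N w / 2 \<le> t" using Nw by (simp add: t_def N_minus_commute)
  have "1 / 4 * t \<le> t\<^sup>2 / (2 * N w)"
  proof -
    have "t * (N w / 2) \<le> t * t" using t Nw by (intro mult_left_mono) auto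
    thus ?thesis using Nw by (simp add: field_simps power2_eq_square)
  qed
  hence "c2\<^sup>2 / cinf * (1 / 4 * t) \<le> c2\<^sup>2 / cinf * (t\<^sup>2 / (2 * N w))"
    using cinf_pos by (intro mult_left_mono) auto
  hence "c2\<^sup>2 / (4 * cinf) * t \<le> 1 / 2 * (c2\<^sup>2 / (cinf * N w)) * t\<^sup>2"
    by (simp add: mult_ac)
  hence "ereal (l * (1 - l)) * ereal (c2\<^sup>2 / (4 * cinf) * t)
      \<le> ereal (l * (1 - l)) * ereal (1 / 2 * (c2\<^sup>2 / (cinf * N w)) * t\<^sup>2)"
    using l by (intro ereal_mult_left_mono) auto
  hence "neg_entropy (l *\<^sub>R x + (1 - l) *\<^sub>R w) + ereal (l * (1 - l)) * ereal (c2\<^sup>2 / (4 * cinf) * t)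
      \<le> neg_entropy (l *\<^sub>R x + (1 - l) *\<^sub>R w)
        + ereal (l * (1 - l)) * ereal (1 / 2 * (c2\<^sup>2 / (cinf * N w)) * t\<^sup>2)"
    by (intro add_left_mono)
  also have "\<dots> \<le> ereal l * neg_entropy x + ereal (1 - l) * neg_entropy w"
    unfolding t_def using l Nw N_nonneg[of x] x wn by (intro neg_entropy_N_strong_convex) auto
  finally show "neg_entropy (l *\<^sub>R z + (1 - l) *\<^sub>R w)
      + ereal (l * (1 - l)) * ereal (c2\<^sup>2 / (4 * cinf) * N (z - w))
      \<le> ereal l * neg_entropy z + ereal (1 - l) * neg_entropy w" by (simp add: t_def)
qed (use x pos_subset_nonneg c2_pos cinf_pos in
      \<open>auto simp: eff_dom_neg_entropy convex_fun_neg_entropy\<close>)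

text \<open>
  The points \<open>s *\<^sub>R 1\<close> and \<open>(s + 1) *\<^sub>R 1\<close> have a distance independent of \<open>s\<close>, while
  \<open>kl a c \<le> (a - c)\<^sup>2 / c\<close> bounds their midpoint convexity gap by a multiple of \<open>1 / s\<close>.  A gauge
  would have to be nonpositive at that distance.
\<close>

lemma not_unif_convex_on_neg_entropy: "\<not> unif_convex_on N neg_entropy pos_orthant"
proof
  assume "unif_convex_on N neg_entropy pos_orthant"
  then obtain \<psi> where \<psi>: "unif_convex_rel N neg_entropy pos_orthant pos_orthant \<psi>"
    by (auto simp: unif_convex_on_def)
  have pos: "0 < \<psi> (N 1)" using \<psi> N_one_pos by (auto simp: unif_convex_rel_def)
  have bound: "\<psi> (N 1) \<le> ereal (CARD('n) / s)" if s: "s > 0" for s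
  proof -
    define c where "c = s + 1 / 2"
    define z :: "real \<Rightarrow> real^'n" where "z = (\<lambda>s. s *\<^sub>R 1)"
    have c: "c = 1 / 2 * (s + 1) + (1 - 1 / 2) * s" by (simp add: c_def field_simps)
    have zpos: "z u \<in> pos_orthant" and znn: "z u \<in> nonneg_orthant" if "u > 0" for u
      using that by (auto simp: z_def pos_orthant_def nonneg_orthant_def)
    have E: "neg_entropy (z u) = ereal (CARD('n) * (u * ln u))" if "u > 0" for u
      using znn[OF that] by (simp add: neg_entropy_nonneg) (simp add: z_def entropy_sum_def)
    have "(1 / 2) *\<^sub>R z (s + 1) + (1 - 1 / 2) *\<^sub>R z s = z c" "z (s + 1) - z s = 1"
      by (simp_all add: z_def c_def vec_eq_iff field_simps)
    moreover have "neg_entropy ((1 / 2) *\<^sub>R z (s + 1) + (1 - 1 / 2) *\<^sub>R z s)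
        + ereal (1 / 2 * (1 - 1 / 2)) * \<psi> (N (z (s + 1) - z s))
        \<le> ereal (1 / 2) * neg_entropy (z (s + 1)) + ereal (1 - 1 / 2) * neg_entropy (z s)"
    proof -
      have "(1 / 2 :: real) \<in> {0<..<1}" by simp
      moreover have "z (s + 1) \<in> pos_orthant" "z s \<in> pos_orthant" using zpos s by auto
      ultimately show ?thesis using \<psi> unfolding unif_convex_rel_def by blast
    qed
    ultimately have ineq: "ereal (CARD('n) * (c * ln c)) + ereal (1 / 4) * \<psi> (N 1)
        \<le> ereal (1 / 2 * (CARD('n) * ((s + 1) * ln (s + 1))) + 1 / 2 * (CARD('n) * (s * ln s)))"
      using s E[of "s + 1"] E[of s] E[of c] by (simp add: c_def)
    then obtain p where p: "\<psi> (N 1) = ereal p" using pos by (cases "\<psi> (N 1)") auto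
    have "1 / 4 * p \<le> CARD('n) * (1 / 2 * ((s + 1) * ln (s + 1)) + (1 - 1 / 2) * (s * ln s) - c * ln c)"
      using ineq unfolding p by (simp add: algebra_simps)
    also have "\<dots> = CARD('n) * (1 / 2 * kl (s + 1) c + (1 - 1 / 2) * kl s c)"
      using kl_convex_combination[OF c] by simp
    also have "\<dots> \<le> CARD('n) * (1 / 2 * ((s + 1 - c)\<^sup>2 / c) + (1 - 1 / 2) * ((s - c)\<^sup>2 / c))"
      using s by (intro mult_left_mono add_mono kl_le_quadratic) (auto simp: c_def)
    also have "\<dots> = 1 / 4 * (CARD('n) / c)"
    proof -
      have "s + 1 - c = 1 / 2" "s - c = - 1 / 2" by (simp_all add: c_def)
      thus ?thesis by (simp only:) (simp add: power2_eq_square)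
    qed
    finally have "p \<le> CARD('n) / c" by simp
    also have "\<dots> \<le> CARD('n) / s" using s by (intro divide_left_mono) (auto simp: c_def)
    finally show ?thesis by (simp add: p)
  qed
  \<comment> \<open>The bound at \<open>s = 2 * CARD('n) / p\<close> reads \<open>p \<le> p / 2\<close>.\<close>
  obtain p where p: "\<psi> (N 1) = ereal p" "p > 0" using bound[of 1] pos by (cases "\<psi> (N 1)") auto
  have "p \<le> CARD('n) / (2 * CARD('n) / p)" using bound[of "2 * CARD('n) / p"] p by simp
  thus False using p by simp
qed

text \<open>
  A bound on the second sequence suffices, since the distance estimate needs a bound for one of the
  two points only.
\<close>

lemma sequentially_consistent_neg_entropy: "sequentially_consistent N neg_entropy pos_orthant"
  unfolding sequentially_consistent_def eff_dom_neg_entropy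
proof (intro allI impI)
  fix xs ys :: "nat \<Rightarrow> real^'n"
  assume xs: "\<forall>i. xs i \<in> nonneg_orthant" and ys: "\<forall>i. ys i \<in> pos_orthant"
    and bd: "norm_bounded N (range ys)"
    and lim: "(\<lambda>i. bregman_div N neg_entropy pos_orthant (xs i) (ys i)) \<longlonglongrightarrow> 0"
  obtain M where "\<forall>i. N (ys i) \<le> M" using bd by (auto simp: norm_bounded_def)
  hence M: "infnorm (ys i) \<le> cinf * M" for i using infnorm_le_of_N_le by blast
  define d where "d = (\<lambda>i. kl_sum (xs i) (ys i))"
  have d: "d \<longlonglongrightarrow> 0"
    using lim xs ys by (simp add: bregman_div_neg_entropy d_def zero_ereal_def)
  have "(\<lambda>i. d i + sqrt ((d i)\<^sup>2 + 2 * d i * (cinf * M))) \<longlonglongrightarrow> 0 + sqrt (0\<^sup>2 + 2 * 0 * (cinf * M))"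
    by (intro tendsto_intros d)
  hence bound_lim: "(\<lambda>i. sqrt DIM(real^'n) * (d i + sqrt ((d i)\<^sup>2 + 2 * d i * (cinf * M)))) \<longlonglongrightarrow> 0"
    by (intro tendsto_mult_right_zero) simp
  have bound: "norm (xs i - ys i)
      \<le> sqrt DIM(real^'n) * (d i + sqrt ((d i)\<^sup>2 + 2 * d i * (cinf * M)))" for i
  proof -
    have "infnorm (xs i - ys i) \<le> d i + sqrt ((d i)\<^sup>2 + 2 * d i * (cinf * M))"
      using xs ys M[of i] by (intro infnorm_diff_le_kl_sum) (auto simp: d_def)
    thus ?thesis using norm_le_infnorm[of "xs i - ys i"]
      by (meson mult_left_mono order_trans real_sqrt_ge_zero of_nat_0_le_iff)
  qed
  have "(\<lambda>i. xs i - ys i) \<longlonglongrightarrow> 0"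
    by (rule Lim_null_comparison[OF always_eventually bound_lim]) (use bound in blast)
  thus "(\<lambda>i. N (xs i - ys i)) \<longlonglongrightarrow> 0" by (simp add: N_tendsto_zero_iff)
qed

lemma norm_bounded_infnorm_ball:
  assumes "\<And>x. x \<in> S \<Longrightarrow> infnorm (x - a) \<le> r"
  shows "norm_bounded N S"
  unfolding norm_bounded_iff
proof (rule bounded_subset[OF bounded_cball])
  show "S \<subseteq> cball a (sqrt DIM(real^'n) * r)"
  proof
    fix x assume "x \<in> S"
    hence "norm (x - a) \<le> sqrt DIM(real^'n) * r"
      using assms[of x] norm_le_infnorm[of "x - a"]
      by (meson mult_left_mono order_trans real_sqrt_ge_zero of_nat_0_le_iff)
    thus "x \<in> cball a (sqrt DIM(real^'n) * r)" by (simp add: dist_norm norm_minus_commute)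
  qed
qed

lemma norm_bounded_level_set_snd:
  assumes "x \<in> nonneg_orthant"
  shows "norm_bounded N {y \<in> pos_orthant. bregman_div N neg_entropy pos_orthant x y \<le> ereal \<gamma>}"
proof (rule norm_bounded_infnorm_ball[of _ x "\<gamma> + sqrt (\<gamma>\<^sup>2 + 2 * \<gamma> * infnorm x)"])
  fix y assume "y \<in> {y \<in> pos_orthant. bregman_div N neg_entropy pos_orthant x y \<le> ereal \<gamma>}"
  hence "infnorm (x - y) \<le> \<gamma> + sqrt (\<gamma>\<^sup>2 + 2 * \<gamma> * infnorm x)"
    using assms by (intro infnorm_diff_le_kl_sum) (auto simp: bregman_div_neg_entropy)
  thus "infnorm (y - x) \<le> \<gamma> + sqrt (\<gamma>\<^sup>2 + 2 * \<gamma> * infnorm x)" by (simp add: infnorm_sub)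
qed

lemma norm_bounded_level_set_fst:
  assumes "y \<in> pos_orthant"
  shows "norm_bounded N {x \<in> nonneg_orthant. bregman_div N neg_entropy pos_orthant x y \<le> ereal \<gamma>}"
proof (rule norm_bounded_infnorm_ball[of _ y "\<gamma> + sqrt (\<gamma>\<^sup>2 + 2 * \<gamma> * infnorm y)"])
  fix x assume "x \<in> {x \<in> nonneg_orthant. bregman_div N neg_entropy pos_orthant x y \<le> ereal \<gamma>}"
  thus "infnorm (x - y) \<le> \<gamma> + sqrt (\<gamma>\<^sup>2 + 2 * \<gamma> * infnorm y)"
    using assms by (intro infnorm_diff_le_kl_sum) (auto simp: bregman_div_neg_entropy)
qed

lemma bregman_div_tendsto_zero:
  assumes x: "x \<in> nonneg_orthant" and ys: "\<And>i. ys i \<in> pos_orthant" and lim: "ys \<longlonglongrightarrow> x"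
  shows "(\<lambda>i. bregman_div N neg_entropy pos_orthant x (ys i)) \<longlonglongrightarrow> 0"
proof -
  have "(\<lambda>i. kl (x $ k) (ys i $ k)) \<longlonglongrightarrow> 0" for k
    using x by (intro tendsto_kl tendsto_vec_nth lim) (auto simp: nonneg_orthant_def)
  hence "(\<lambda>i. kl_sum x (ys i)) \<longlonglongrightarrow> 0"
    unfolding kl_sum_def by (intro tendsto_null_sum)
  thus ?thesis using x ys by (simp add: bregman_div_neg_entropy zero_ereal_def)
qed

lemma bregman_function_neg_entropy: "bregman_function N neg_entropy pos_orthant"
  unfolding bregman_function_def eff_dom_neg_entropy
proof (intro conjI)
  show "pos_orthant = norm_topology N interior_of nonneg_orthant"
    by (simp add: norm_topology_eq interior_nonneg_orthant)
  show "pos_orthant \<noteq> ({} :: (real^'n) set)"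
    by (auto simp: pos_orthant_def intro!: exI[of _ 1])
  show "\<forall>y\<in>pos_orthant. \<exists>L. has_gateaux_deriv N neg_entropy y L"
    using has_gateaux_deriv_neg_entropy by blast
  show "convex_fun (neg_entropy :: real^'n \<Rightarrow> ereal)" by (rule convex_fun_neg_entropy)
  show "lower_semicont N neg_entropy"
    unfolding lower_semicont_def norm_topology_eq by (simp add: open_superlevel_neg_entropy)
  show "strictly_convex_fun_on nonneg_orthant (neg_entropy :: real^'n \<Rightarrow> ereal)"
    by (rule strictly_convex_neg_entropy)
  show "\<forall>\<gamma>::real. \<forall>x\<in>nonneg_orthant.
      norm_bounded N {y \<in> pos_orthant. bregman_div N neg_entropy pos_orthant x y \<le> ereal \<gamma>}"
    using norm_bounded_level_set_snd by blast
  show "\<forall>x\<in>nonneg_orthant. \<forall>ys::nat \<Rightarrow> real^'n. (\<forall>i. ys i \<in> pos_orthant) \<longrightarrow>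
      (\<lambda>i. N (x - ys i)) \<longlonglongrightarrow> 0 \<longrightarrow> (\<lambda>i. bregman_div N neg_entropy pos_orthant x (ys i)) \<longlonglongrightarrow> 0"
  proof (intro ballI allI impI)
    fix x :: "real^'n" and ys
    assume x: "x \<in> nonneg_orthant" and ys: "\<forall>i. ys i \<in> pos_orthant"
      and "(\<lambda>i. N (x - ys i)) \<longlonglongrightarrow> 0"
    hence "ys \<longlonglongrightarrow> x" by (simp add: N_minus_commute[of x] N_tendsto_iff)
    with x ys show "(\<lambda>i. bregman_div N neg_entropy pos_orthant x (ys i)) \<longlonglongrightarrow> 0"
      by (intro bregman_div_tendsto_zero) auto
  qed
  show "\<forall>(xs::nat \<Rightarrow> real^'n) ys. \<forall>y\<in>nonneg_orthant.
      (\<forall>i. xs i \<in> nonneg_orthant) \<longrightarrow> norm_bounded N (range xs) \<longrightarrow> (\<forall>i. ys i \<in> pos_orthant) \<longrightarrow>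
      (\<lambda>i. bregman_div N neg_entropy pos_orthant (xs i) (ys i)) \<longlonglongrightarrow> 0 \<longrightarrow>
      (\<lambda>i. N (ys i - y)) \<longlonglongrightarrow> 0 \<longrightarrow> (\<lambda>i. N (xs i - y)) \<longlonglongrightarrow> 0"
  proof (intro allI ballI impI)
    fix xs ys :: "nat \<Rightarrow> real^'n" and y
    assume xs: "\<forall>i. xs i \<in> nonneg_orthant" and ys: "\<forall>i. ys i \<in> pos_orthant"
      and lim: "(\<lambda>i. bregman_div N neg_entropy pos_orthant (xs i) (ys i)) \<longlonglongrightarrow> 0"
      and "(\<lambda>i. N (ys i - y)) \<longlonglongrightarrow> 0"
    hence y: "ys \<longlonglongrightarrow> y" by (simp add: N_tendsto_iff)
    hence "norm_bounded N (range ys)"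
      unfolding norm_bounded_iff by (rule convergent_imp_bounded)
    hence "(\<lambda>i. xs i - ys i) \<longlonglongrightarrow> 0"
      using sequentially_consistent_neg_entropy xs ys lim
      unfolding sequentially_consistent_def eff_dom_neg_entropy N_tendsto_zero_iff by blast
    from tendsto_add[OF this y] show "(\<lambda>i. N (xs i - y)) \<longlonglongrightarrow> 0" by (simp add: N_tendsto_iff)
  qed
qed

text \<open>
  Every term involves \<open>ys i\<close> only through its coordinates and their logarithms, which converge
  because the coordinates of \<open>y\<close> are positive.
\<close>

lemma limiting_difference_property_neg_entropy:
  "limiting_difference_property N neg_entropy pos_orthant"
  unfolding limiting_difference_property_def eff_dom_neg_entropy
proof (intro ballI allI impI)
  fix x y :: "real^'n" and ys
  assume x: "x \<in> nonneg_orthant" and y: "y \<in> pos_orthant" and ys: "\<forall>i. ys i \<in> pos_orthant"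
    and "weakly_converges N ys y"
  hence lim: "(\<lambda>i. ys i $ k) \<longlonglongrightarrow> y $ k" for k using weakly_converges_imp_tendsto by blast
  have yn: "y \<in> nonneg_orthant" using y pos_subset_nonneg by blast
  have yk: "y $ k \<noteq> 0" for k using y by (simp add: pos_orthant_def less_imp_neq[THEN not_sym])
  have "(\<lambda>i. \<Sum>k\<in>UNIV. kl (x $ k) (ys i $ k) - kl (y $ k) (ys i $ k))
      \<longlonglongrightarrow> (\<Sum>k\<in>UNIV. kl (x $ k) (y $ k) - kl (y $ k) (y $ k))"
    unfolding kl_def by (intro tendsto_intros lim yk)
  hence "(\<lambda>i. kl_sum x (ys i) - kl_sum y (ys i)) \<longlonglongrightarrow> kl_sum x y"
    by (simp add: kl_sum_def sum_subtractf)
  thus "(\<lambda>i. bregman_div N neg_entropy pos_orthant x (ys i)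
          - bregman_div N neg_entropy pos_orthant y (ys i))
      \<longlonglongrightarrow> bregman_div N neg_entropy pos_orthant x y"
    using x y yn ys by (simp add: bregman_div_neg_entropy)
qed

end

section \<open>The properties of the negative entropy\<close>

theorem mainTheorem10:
  fixes N :: "real ^ 'n::finite \<Rightarrow> real" and c2 cinf :: real
  assumes "is_norm N"
    and "c2 > 0" and "cinf > 0"
    and "\<And>v. c2 * N v \<le> norm v"
    and "\<And>v. infnorm v \<le> cinf * N v"
  shows
    "((\<forall>S::(real ^ 'n) set. S \<noteq> {} \<and> norm_bounded N S \<and> convex S \<and> S \<subseteq> nonneg_orthant \<longrightarrow>
         strong_convex_on N neg_entropy S) \<and>
      (\<forall>(S::(real ^ 'n) set) M. S \<noteq> {} \<and> norm_bounded N S \<and> convex S \<and> S \<subseteq> pos_orthant \<and>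
         M > 0 \<and> (\<forall>s\<in>S. N s \<le> M) \<longrightarrow>
         strong_convexity_parameter N neg_entropy S (c2\<^sup>2 / (cinf * M)))) \<and>
     (\<forall>x\<in>nonneg_orthant.
         unif_convex_rel N neg_entropy {x} (pos_orthant \<inter> {w. N w > 2 * N x})
           (\<lambda>t. ereal (c2\<^sup>2 / (4 * cinf) * t))) \<and>
     \<not> unif_convex_on N neg_entropy (pos_orthant :: (real ^ 'n) set) \<and>
     (sequentially_consistent N neg_entropy pos_orthant \<and>
      bregman_function N neg_entropy pos_orthant \<and>
      limiting_difference_property N neg_entropy pos_orthant \<and>
      (\<forall>y\<in>pos_orthant. \<forall>\<gamma>::real.
         norm_bounded N
           {x \<in> eff_dom neg_entropy. bregman_div N neg_entropy pos_orthant x y \<le> ereal \<gamma>}))"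
proof -
  interpret coordinate_norm N c2 cinf
    using assms by unfold_locales auto
  show ?thesis
    unfolding eff_dom_neg_entropy
    by (intro conjI allI ballI impI strong_convex_on_neg_entropy
        strong_convexity_parameter_neg_entropy unif_convex_rel_neg_entropy_far
        not_unif_convex_on_neg_entropy sequentially_consistent_neg_entropy
        bregman_function_neg_entropy limiting_difference_property_neg_entropy
        norm_bounded_level_set_fst)
      (use pos_subset_nonneg in blast)+
qed

end
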